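(* Let $R>0$, let $P_0$ be a probability distribution on $[0,R]$ with strictly positive density function $p_0$, let $(\lambda_t)_{t\ge 1}$ satisfy $\lambda_1=1$ and $0<\lambda_t<1$ for all $t\ge 2$, and let $r_1^*,r_2^*,\ldots\in[0,R]$ be an arbitrary sequence. For $\alpha\in[0,1]$ let $r_t(\alpha)$ be the output of the regularized-belief algorithm, and define $\psi(r)=\mathbb{E}_{r^*\sim P_0}[l_\alpha(r,r^* )]$ (which depends on $\alpha$). Then for all $\alpha\in[0,1]$, the output satisfies $$r_1(\alpha)=\operatorname*{argmin}_{r\in\mathbb{R}}\psi(r),$$ and for all $t\ge 2$, $$r_t(\alpha)=\operatorname*{argmin}_{r\in\mathbb{R}}\left[\frac{\lambda_t(t-1)}{1-\lambda_t}\psi(r)+\sum_{i=1}^{t-1}l_\alpha(r,r_i^* )\right].$$ Specifically: (i) $\psi$ is strongly convex with coefficient $\inf_{r\in[0,R]}p_0(r)$, if the latter is positive; (ii) if $P_0$ is the uniform distribution on $[0,R]$, then $\psi$ is a quadratic function centered at $\alpha R$, $$\psi(r)=\frac{1}{2R}r^2-\alpha r+\frac12\alpha R.$$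
   Context: Quantile loss: $l_\alpha(r,r^* )=(\mathbf{1}[r\ge r^*]-\alpha)(r-r^* )$. Quantile: the $\alpha$-quantile of a real random variable $X$ (or of its distribution) is $q_\alpha(X)=\min\{x:\mathbb{P}(X\le x)\ge\alpha\}$. $\bar P(r^*_{1:n})$ denotes the empirical distribution of $r_1^*,\ldots,r_n^*$. Regularized-belief algorithm: given the prior $P_0$ and the step sizes $(\lambda_t)$, in round $t$ it forms the belief $P_t=\lambda_tP_0+(1-\lambda_t)\bar P(r^*_{1:t-1})$ (so $P_1=P_0$ since $\lambda_1=1$), outputs the threshold $r_t(\alpha)=q_\alpha(P_t)$ for every queried $\alpha\in[0,1]$, and then observes the true score $r_t^*\in[0,R]$.
   Formalization: (i) and (ii) are stated for r in [0,R], as ψ is affine outside it; the quantile is the minimum over x in [0,R], as q_0 does not exist over all reals; for α=0 or 1 the argmin over the reals is not unique, so r_t(α) is stated to be the only minimizer lying in [0,R]. *)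

theory Defs
  imports "HOL-Probability.Probability"
begin

definition quantile_loss :: "real \<Rightarrow> real \<Rightarrow> real \<Rightarrow> real" where
  "quantile_loss \<alpha> r s = ((if r \<ge> s then 1 else 0) - \<alpha>) * (r - s)"

text \<open>The minimum in the definition of the quantile ranges over a set \<open>S\<close> of admissible thresholds.
  With \<open>S = UNIV\<close> there is no minimum for \<open>\<alpha> = 0\<close>, because then every real number satisfies the
  constraint. For a distribution on an interval \<open>{a..b}\<close>, taking \<open>S = {a..b}\<close> changes nothing for
  \<open>0 < \<alpha> \<le> 1\<close> and gives the left endpoint for \<open>\<alpha> = 0\<close>; see the two lemmas below.\<close>

definition quantile_in :: "real set \<Rightarrow> real measure \<Rightarrow> real \<Rightarrow> real" where
  "quantile_in S M \<alpha> = (LEAST x. x \<in> S \<and> \<alpha> \<le> cdf M x)"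

lemma quantile_in_eq_quantile:
  assumes "real_distribution M" and supp: "measure M {a..b} = 1"
    and \<alpha>: "0 < \<alpha>" "\<alpha> \<le> 1"
  shows "quantile_in {a..b} M \<alpha> = (LEAST x. \<alpha> \<le> cdf M x)"
proof -
  interpret real_distribution M by fact
  have ge_a: "a \<le> x" if "\<alpha> \<le> cdf M x" for x
  proof (rule ccontr)
    assume "\<not> a \<le> x"
    then have "{a..b} \<inter> {..x} = {}" by auto
    then have "measure M ({a..b} \<union> {..x}) = measure M {a..b} + measure M {..x}"
      by (intro finite_measure_Union) auto
    then have "measure M {..x} \<le> 0"
      using supp prob_le_1[of "{a..b} \<union> {..x}"] by simp
    with that \<alpha> show False by (simp add: cdf_def)
  qed
  have "measure M {a..b} \<le> measure M {..b}"
    by (intro finite_measure_mono) auto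
  then have at_b: "\<alpha> \<le> cdf M b"
    using supp \<alpha> by (simp add: cdf_def)
  have "(x \<in> {a..b} \<and> \<alpha> \<le> cdf M x \<and> (\<forall>y. y \<in> {a..b} \<and> \<alpha> \<le> cdf M y \<longrightarrow> x \<le> y)) \<longleftrightarrow>
        (\<alpha> \<le> cdf M x \<and> (\<forall>y. \<alpha> \<le> cdf M y \<longrightarrow> x \<le> y))" for x
    using ge_a at_b by (meson atLeastAtMost_iff le_cases order_trans)
  then show ?thesis
    by (simp add: quantile_in_def Least_def conj_assoc)
qed

lemma quantile_in_0:
  assumes "a \<le> b"
  shows "quantile_in {a..b} M 0 = a"
  unfolding quantile_in_def
  by (rule Least_equality) (use assms in \<open>auto simp: cdf_def\<close>)

text \<open>The mixture \<open>w * M + (1 - w) * N\<close> of two measures on the same measurable space.\<close>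

definition mixture :: "real \<Rightarrow> 'a measure \<Rightarrow> 'a measure \<Rightarrow> 'a measure" where
  "mixture w M N = measure_of (space M) (sets M)
     (\<lambda>A. ennreal w * emeasure M A + ennreal (1 - w) * emeasure N A)"

lemma space_mixture [simp]: "space (mixture w M N) = space M"
  and sets_mixture [simp, measurable_cong]: "sets (mixture w M N) = sets M"
  by (simp_all add: mixture_def)

lemma emeasure_mixture:
  assumes "sets N = sets M" and A: "A \<in> sets M"
  shows "emeasure (mixture w M N) A = ennreal w * emeasure M A + ennreal (1 - w) * emeasure N A"
  using mixture_def
proof (rule emeasure_measure_of)
  show "sets M \<subseteq> Pow (space M)" by (rule sets.space_closed)
  show "positive (sets (mixture w M N))
      (\<lambda>A. ennreal w * emeasure M A + ennreal (1 - w) * emeasure N A)"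
    by (simp add: positive_def)
  show "countably_additive (sets (mixture w M N))
      (\<lambda>A. ennreal w * emeasure M A + ennreal (1 - w) * emeasure N A)"
  proof (rule countably_additiveI)
    fix B :: "nat \<Rightarrow> 'a set"
    assume B: "range B \<subseteq> sets (mixture w M N)" "disjoint_family B"
    then have "(\<Sum>i. emeasure M (B i)) = emeasure M (\<Union>i. B i)"
      and "(\<Sum>i. emeasure N (B i)) = emeasure N (\<Union>i. B i)"
      using assms(1) by (auto intro!: suminf_emeasure)
    then show "(\<Sum>i. ennreal w * emeasure M (B i) + ennreal (1 - w) * emeasure N (B i)) =
        ennreal w * emeasure M (\<Union>i. B i) + ennreal (1 - w) * emeasure N (\<Union>i. B i)"
      by (simp add: suminf_add[symmetric])
  qed
  show "A \<in> sets (mixture w M N)" using A by simp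
qed

text \<open>The distribution of \<open>rs I\<close> for an index \<open>I\<close> drawn uniformly from \<open>{1..n}\<close>, so repeated scores
  count with multiplicity. For \<open>n = 0\<close> it is the zero measure, which only enters with weight zero.\<close>

definition empirical :: "(nat \<Rightarrow> real) \<Rightarrow> nat \<Rightarrow> real measure" where
  "empirical rs n = distr (uniform_count_measure {1..n}) borel rs"

definition belief :: "real measure \<Rightarrow> (nat \<Rightarrow> real) \<Rightarrow> (nat \<Rightarrow> real) \<Rightarrow> nat \<Rightarrow> real measure" where
  "belief P0 lam rs t = mixture (lam t) P0 (empirical rs (t - 1))"

definition threshold ::
  "real \<Rightarrow> real measure \<Rightarrow> (nat \<Rightarrow> real) \<Rightarrow> (nat \<Rightarrow> real) \<Rightarrow> nat \<Rightarrow> real \<Rightarrow> real" where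
  "threshold R P0 lam rs t \<alpha> = quantile_in {0..R} (belief P0 lam rs t) \<alpha>"

definition expected_loss :: "real measure \<Rightarrow> real \<Rightarrow> real \<Rightarrow> real" where
  "expected_loss P0 \<alpha> r = (LINT s|P0. quantile_loss \<alpha> r s)"

definition Argmin :: "(real \<Rightarrow> real) \<Rightarrow> real set" where
  "Argmin f = {r. is_arg_min f (\<lambda>_. True) r}"

definition strongly_convex_on :: "real set \<Rightarrow> real \<Rightarrow> (real \<Rightarrow> real) \<Rightarrow> bool" where
  "strongly_convex_on S \<mu> f \<longleftrightarrow> convex S \<and>
     (\<forall>x\<in>S. \<forall>y\<in>S. \<forall>u\<in>{0..1}.
        f (u * x + (1 - u) * y) \<le> u * f x + (1 - u) * f y - \<mu> / 2 * u * (1 - u) * (x - y)\<^sup>2)"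

end

(* Integrating the subgradient of the quantile loss in its first argument gives
   (b - a) (F a - alpha) <= psi b - psi a <= (b - a) (F b - alpha) for a <= b, where F is the
   distribution function of P0. The regularized objective satisfies the same bounds, up to the
   positive factor (t - 1) / (1 - lambda), with F replaced by the distribution function of the
   belief. Hence both objectives decrease before the quantile and increase after it; strictly so,
   because a positive density makes F strictly increasing. As F is continuous, the bounds also give
   psi' = F - alpha, from which strong convexity and the uniform case follow. *)
theory Submission
  imports Defs
begin

section \<open>Functions with a monotone difference quotient bound\<close>

text \<open>To the right of \<open>q\<close> the lower bound is nonnegative. To the left,
  \<open>G m \<le> \<alpha>\<close> makes \<open>f\<close> nonincreasing, but \<open>G\<close> may
  jump above \<alpha> at \<open>q\<close> itself. The comparison therefore stops at some
  \<open>m < q\<close>, and the upper bound on the remaining piece is a multiple of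
  \<open>q - m\<close>, which can be made arbitrarily small.\<close>

lemma slope_global_minimum:
  fixes f G :: "real \<Rightarrow> real"
  assumes K: "K > 0"
    and lower: "\<And>a b. a \<le> b \<Longrightarrow> K * ((b - a) * (G a - \<alpha>)) \<le> f b - f a"
    and upper: "\<And>a b. a \<le> b \<Longrightarrow> f b - f a \<le> K * ((b - a) * (G b - \<alpha>))"
    and q: "\<alpha> \<le> G q" and below: "\<And>m. m < q \<Longrightarrow> G m \<le> \<alpha>"
  shows "f q \<le> f x"
proof (cases "q \<le> x")
  case True
  have "0 \<le> K * ((x - q) * (G q - \<alpha>))" using K True q by simp
  with lower[OF True] show ?thesis by linarith
next
  case False
  \<comment> \<open>The summand 1 keeps \<open>C\<close> positive when
    \<open>G q = \<alpha>\<close>, so that \<open>e / C\<close> is a valid step length.\<close>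
  define C where "C = K * (G q - \<alpha>) + 1"
  have C: "C > 0" using K q by (simp add: C_def add_nonneg_pos)
  show ?thesis
  proof (rule field_le_epsilon)
    fix e :: real assume e: "e > 0"
    define m where "m = max x (q - e / C)"
    have m: "x \<le> m" "m < q" "q - m \<le> e / C"
      using False e C by (auto simp: m_def)
    have "K * ((m - x) * (G m - \<alpha>)) \<le> 0"
      using K m below[OF m(2)] by (simp add: mult_nonneg_nonpos)
    then have "f m \<le> f x" using upper[OF m(1)] by linarith
    moreover have "K * ((q - m) * (G q - \<alpha>)) \<le> (q - m) * C"
      using m(2) by (simp add: C_def algebra_simps)
    moreover have "(q - m) * C \<le> e"
      using m(3) C by (simp add: pos_le_divide_eq)
    moreover have "f q - f m \<le> K * ((q - m) * (G q - \<alpha>))"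
      using upper[of m q] m(2) by simp
    ultimately show "f q \<le> f x + e" by linarith
  qed
qed

text \<open>Uniqueness requires \<open>G\<close> to avoid the level \<alpha> away from
  \<open>q\<close>. The set \<open>S\<close> is a parameter because this can hold on an interval and
  fail on the whole line: for \<alpha> equal to 0 or 1 the distribution function stays at the level
  \<alpha> on a half-line.\<close>

lemma Argmin_slope:
  fixes f G :: "real \<Rightarrow> real"
  assumes K: "K > 0" and G: "mono G"
    and lower: "\<And>a b. a \<le> b \<Longrightarrow> K * ((b - a) * (G a - \<alpha>)) \<le> f b - f a"
    and upper: "\<And>a b. a \<le> b \<Longrightarrow> f b - f a \<le> K * ((b - a) * (G b - \<alpha>))"
    and q: "\<alpha> \<le> G q" and below: "\<And>m. m < q \<Longrightarrow> G m \<le> \<alpha>"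
    and S: "convex S" "q \<in> S" and ne: "\<And>m. m \<in> S \<Longrightarrow> m \<noteq> q \<Longrightarrow> G m \<noteq> \<alpha>"
  shows "Argmin f \<inter> S = {q}"
proof -
  have min: "f q \<le> f x" for x
    using slope_global_minimum[OF K lower upper q below] .
  have strict: "f q < f x" if x: "x \<in> S" "x \<noteq> q" for x
  proof -
    \<comment> \<open>The midpoint separates the two estimates: \<open>f\<close> changes strictly
      between \<open>x\<close> and \<open>m\<close>, where the slope bound involves
      \<open>G m \<noteq> \<alpha>\<close>, and \<open>f q \<le> f m\<close> already holds.\<close>
    define m where "m = (x + q) / 2"
    have "(1 / 2) *\<^sub>R x + (1 / 2) *\<^sub>R q \<in> S"
      using S x(1) by (intro convexD) auto
    then have "m \<in> S" by (simp add: m_def field_simps)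
    have "m \<noteq> q" using x(2) by (simp add: m_def)
    have Gm: "G m \<noteq> \<alpha>" using ne[OF \<open>m \<in> S\<close> \<open>m \<noteq> q\<close>] .
    show ?thesis
    proof (cases "x < q")
      case True
      then have m: "x < m" "m < q" by (auto simp: m_def)
      have "G m < \<alpha>" using below[OF m(2)] Gm by simp
      then have "K * ((m - x) * (G m - \<alpha>)) < 0"
        using K m(1) by (simp add: mult_pos_neg)
      with upper[of x m] m(1) min[of m] show ?thesis by linarith
    next
      case False
      with x(2) have m: "q < m" "m < x" by (auto simp: m_def)
      have "G q \<le> G m" using monoD[OF G, of q m] m(1) by simp
      with q Gm have "G m > \<alpha>" by simp
      then have "K * ((x - m) * (G m - \<alpha>)) > 0"
        using K m(2) by simp
      with lower[of m x] m(2) min[of m] show ?thesis by linarith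
    qed
  qed
  have "f q < f x" if "x \<in> Argmin f" "x \<in> S" "x \<noteq> q" for x
    using strict that by blast
  moreover have "\<not> f q < f x" if "x \<in> Argmin f" for x
    using that by (simp add: Argmin_def is_arg_min_def)
  moreover have "q \<in> Argmin f"
    using min by (simp add: Argmin_def is_arg_min_def not_less)
  ultimately show ?thesis using S(2) by blast
qed

text \<open>The difference quotient between \<open>x\<close> and \<open>y\<close> lies between
  \<open>g x\<close> and \<open>g y\<close>, so its distance from \<open>g x\<close> is at most that
  of \<open>g y\<close>, which tends to 0 by continuity.\<close>

lemma has_real_derivative_slope:
  fixes f g :: "real \<Rightarrow> real"
  assumes lower: "\<And>a b. a \<le> b \<Longrightarrow> (b - a) * g a \<le> f b - f a"
    and upper: "\<And>a b. a \<le> b \<Longrightarrow> f b - f a \<le> (b - a) * g b"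
    and cont: "isCont g x"
  shows "(f has_real_derivative g x) (at x)"
proof -
  have lim: "((\<lambda>y. g y - g x) \<longlongrightarrow> 0) (at x)"
    using cont by (simp add: isCont_def LIM_zero)
  have bound: "\<bar>(f y - f x) / (y - x) - g x\<bar> \<le> \<bar>g y - g x\<bar>" if "y \<noteq> x" for y
  proof (cases "x < y")
    case True
    then have "g x \<le> (f y - f x) / (y - x)" "(f y - f x) / (y - x) \<le> g y"
      using lower[of x y] upper[of x y]
      by (simp_all add: pos_le_divide_eq pos_divide_le_eq mult.commute)
    then show ?thesis by linarith
  next
    case False
    with that have "y < x" by simp
    then have "g y \<le> (f x - f y) / (x - y)" "(f x - f y) / (x - y) \<le> g x"
      using lower[of y x] upper[of y x]
      by (simp_all add: pos_le_divide_eq pos_divide_le_eq mult.commute)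
    moreover have "(f y - f x) / (y - x) = (f x - f y) / (x - y)"
      by (metis minus_diff_eq minus_divide_divide)
    ultimately show ?thesis by linarith
  qed
  have "((\<lambda>y. (f y - f x) / (y - x) - g x) \<longlongrightarrow> 0) (at x)"
    by (rule Lim_null_comparison[OF _ tendsto_rabs_zero[OF lim]])
       (use bound in \<open>auto simp: eventually_at_filter\<close>)
  then show ?thesis
    by (simp add: has_field_derivative_iff LIM_zero_iff)
qed

text \<open>Subtracting \<open>\<mu> / 2 * x\<^sup>2\<close> leaves a function with nondecreasing
  derivative, hence a convex one. Adding the square back produces exactly the strong convexity
  term.\<close>

lemma strongly_convex_on_realI:
  fixes f f' :: "real \<Rightarrow> real"
  assumes S: "convex S"
    and deriv: "\<And>x. x \<in> S \<Longrightarrow> (f has_real_derivative f' x) (at x)"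
    and growth: "\<And>x y. x \<in> S \<Longrightarrow> y \<in> S \<Longrightarrow> x \<le> y \<Longrightarrow> \<mu> * (y - x) \<le> f' y - f' x"
  shows "strongly_convex_on S \<mu> f"
proof -
  define h where "h x = f x - \<mu> / 2 * x\<^sup>2" for x
  have h: "convex_on S h"
  proof (rule convex_on_realI)
    show "connected S" using S by (rule convex_connected)
    show "(h has_real_derivative f' x - \<mu> * x) (at x)" if "x \<in> S" for x
      unfolding h_def by (auto intro!: derivative_eq_intros deriv that)
    show "f' x - \<mu> * x \<le> f' y - \<mu> * y" if "x \<in> S" "y \<in> S" "x \<le> y" for x y
      using growth[OF that] by (simp add: algebra_simps)
  qed
  show ?thesis unfolding strongly_convex_on_def
  proof (intro conjI ballI)
    fix x y u :: real assume xy: "x \<in> S" "y \<in> S" and u: "u \<in> {0..1}"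
    have "h (u * x + (1 - u) * y) \<le> u * h x + (1 - u) * h y"
      using convex_onD[OF h, of "1 - u" x y] xy u by simp
    moreover have "\<mu> / 2 * (u * x + (1 - u) * y)\<^sup>2 =
        u * (\<mu> / 2 * x\<^sup>2) + (1 - u) * (\<mu> / 2 * y\<^sup>2) - \<mu> / 2 * u * (1 - u) * (x - y)\<^sup>2"
      by (simp add: power2_eq_square field_simps)
    ultimately show "f (u * x + (1 - u) * y) \<le>
        u * f x + (1 - u) * f y - \<mu> / 2 * u * (1 - u) * (x - y)\<^sup>2"
      by (simp add: h_def algebra_simps)
  qed (rule S)
qed

section \<open>The quantile of a strictly increasing distribution function\<close>

lemma cdf_eq_0_of_support:
  assumes "real_distribution M" and supp: "measure M {a..b} = 1" and x: "x < a"
  shows "cdf M x = 0"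
proof -
  interpret real_distribution M by fact
  have "measure M ({a..b} \<union> {..x}) = measure M {a..b} + measure M {..x}"
    using x by (intro finite_measure_Union) auto
  then show ?thesis
    using supp prob_le_1[of "{a..b} \<union> {..x}"] measure_nonneg[of M "{..x}"] by (simp add: cdf_def)
qed

lemma cdf_eq_1_of_support:
  assumes "real_distribution M" and supp: "measure M {a..b} = 1" and x: "b \<le> x"
  shows "cdf M x = 1"
proof -
  interpret real_distribution M by fact
  have "measure M {a..b} \<le> measure M {..x}"
    using x by (intro finite_measure_mono) auto
  then show ?thesis using supp prob_le_1[of "{..x}"] by (simp add: cdf_def)
qed

text \<open>\<open>LEAST\<close> is informative only once a least element is known to exist. The
  admissible set contains \<open>b\<close> and is bounded below by \<open>a\<close>, and
  right-continuity of the distribution function puts its infimum into the set.\<close>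

lemma quantile_in_attained:
  assumes "real_distribution M" and ab: "a \<le> b" and b: "\<alpha> \<le> cdf M b"
  shows "quantile_in {a..b} M \<alpha> \<in> {a..b}" "\<alpha> \<le> cdf M (quantile_in {a..b} M \<alpha>)"
    and "\<And>x. x \<in> {a..b} \<Longrightarrow> \<alpha> \<le> cdf M x \<Longrightarrow> quantile_in {a..b} M \<alpha> \<le> x"
proof -
  interpret real_distribution M by fact
  define A where "A = {x. x \<in> {a..b} \<and> \<alpha> \<le> cdf M x}"
  have A: "b \<in> A" "bdd_below A" using ab b by (auto simp: A_def intro: bdd_belowI[of _ a])
  define q where "q = Inf A"
  have qle: "q \<le> x" if "x \<in> A" for x
    unfolding q_def using that A(2) by (rule cInf_lower)
  have aq: "a \<le> q" unfolding q_def using A by (intro cInf_greatest) (auto simp: A_def)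
  have above: "\<alpha> \<le> cdf M x" if qx: "q < x" for x
  proof -
    obtain y where "y \<in> A" "y < x"
      using qx A(1) cInf_lessD[of A x] unfolding q_def by auto
    then show ?thesis using cdf_nondecreasing[of y x] by (auto simp: A_def)
  qed
  have "(cdf M \<longlongrightarrow> cdf M q) (at_right q)"
    using cdf_is_right_cont[of q] by (simp add: continuous_within)
  then have "\<alpha> \<le> cdf M q"
    by (rule tendsto_lowerbound) (auto simp: eventually_at_filter above)
  with aq qle[OF A(1)] have q: "q \<in> A" by (auto simp: A_def)
  have "quantile_in {a..b} M \<alpha> = q"
    unfolding quantile_in_def using q qle by (intro Least_equality) (auto simp: A_def)
  then show "quantile_in {a..b} M \<alpha> \<in> {a..b}" "\<alpha> \<le> cdf M (quantile_in {a..b} M \<alpha>)"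
    and "\<And>x. x \<in> {a..b} \<Longrightarrow> \<alpha> \<le> cdf M x \<Longrightarrow> quantile_in {a..b} M \<alpha> \<le> x"
    using q qle by (auto simp: A_def)
qed

text \<open>Strict growth excludes a second point at level \<alpha> inside the interval. Outside,
  the distribution function takes only the values 0 and 1, so uniqueness extends to the whole line
  for \<alpha> strictly between them.\<close>

lemma Argmin_eq_quantile:
  assumes M: "real_distribution M" and supp: "measure M {a..b} = 1" and ab: "a \<le> b"
    and strict: "strict_mono_on {a..b} (cdf M)"
    and \<alpha>: "\<alpha> \<in> {0..1}" and K: "K > 0"
    and lower: "\<And>x y. x \<le> y \<Longrightarrow> K * ((y - x) * (cdf M x - \<alpha>)) \<le> f y - f x"
    and upper: "\<And>x y. x \<le> y \<Longrightarrow> f y - f x \<le> K * ((y - x) * (cdf M y - \<alpha>))"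
  shows "Argmin f \<inter> {a..b} = {quantile_in {a..b} M \<alpha>}"
    and "0 < \<alpha> \<Longrightarrow> \<alpha> < 1 \<Longrightarrow> Argmin f = {quantile_in {a..b} M \<alpha>}"
proof -
  interpret real_distribution M by fact
  note out = cdf_eq_0_of_support[OF M supp] cdf_eq_1_of_support[OF M supp]
  define q where "q = quantile_in {a..b} M \<alpha>"
  have "\<alpha> \<le> cdf M b" using out(2)[of b] \<alpha> by simp
  note q = quantile_in_attained[OF M ab this, folded q_def]
  have below_in: "cdf M m < \<alpha>" if "m \<in> {a..b}" "m < q" for m
    using q(3)[OF that(1)] that(2) by linarith
  \<comment> \<open>Only the weak inequality holds on the whole line: for \<alpha> = 0 there is
    equality at every point left of \<open>a\<close>.\<close>
  have below: "cdf M m \<le> \<alpha>" if "m < q" for m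
  proof (cases "a \<le> m")
    case True
    then show ?thesis using below_in[of m] that q(1) by auto
  qed (use out(1)[of m] \<alpha> in auto)
  have above_in: "\<alpha> < cdf M m" if "m \<in> {a..b}" "q < m" for m
    using strict_mono_onD[OF strict q(1) that] q(2) by simp
  have ne_in: "cdf M m \<noteq> \<alpha>" if "m \<in> {a..b}" "m \<noteq> q" for m
    using below_in[of m] above_in[of m] that by fastforce
  have mono: "mono (cdf M)" by (simp add: monoI cdf_nondecreasing)
  note Argmin = Argmin_slope[OF K mono lower upper q(2) below]
  show "Argmin f \<inter> {a..b} = {quantile_in {a..b} M \<alpha>}"
    using Argmin[of "{a..b}"] q(1) ne_in by (simp add: q_def)
  assume \<alpha>': "0 < \<alpha>" "\<alpha> < 1"
  have "cdf M m \<noteq> \<alpha>" if "m \<noteq> q" for m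
  proof (cases "m \<in> {a..b}")
    case False
    then consider "m < a" | "b \<le> m" by fastforce
    then show ?thesis using out[of m] \<alpha>' by cases auto
  qed (use ne_in that in auto)
  then show "Argmin f = {quantile_in {a..b} M \<alpha>}"
    using Argmin[of UNIV] by (simp add: q_def)
qed

section \<open>Quantile loss\<close>

text \<open>The loss is convex in its first argument, with right derivative
  \<open>indicat_real {..r} s - \<alpha>\<close> at \<open>r\<close>. The increment over an interval
  lies between the slopes at its two ends.\<close>

lemma quantile_loss_slope:
  assumes "a \<le> b"
  shows "(b - a) * (indicat_real {..a} s - \<alpha>) \<le> quantile_loss \<alpha> b s - quantile_loss \<alpha> a s"
    and "quantile_loss \<alpha> b s - quantile_loss \<alpha> a s \<le> (b - a) * (indicat_real {..b} s - \<alpha>)"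
  using assms by (auto simp: quantile_loss_def algebra_simps)

lemma integrable_quantile_loss:
  assumes "real_distribution M" and id: "integrable M (\<lambda>s. s)"
  shows "integrable M (quantile_loss \<alpha> r)"
proof -
  interpret real_distribution M by fact
  show ?thesis
  proof (rule Bochner_Integration.integrable_bound)
    show "integrable M (\<lambda>s. (1 + \<bar>\<alpha>\<bar>) * \<bar>r - s\<bar>)"
      using id by simp
    show "quantile_loss \<alpha> r \<in> borel_measurable M"
      unfolding quantile_loss_def by measurable
    show "AE s in M. norm (quantile_loss \<alpha> r s) \<le> norm ((1 + \<bar>\<alpha>\<bar>) * \<bar>r - s\<bar>)"
      by (auto simp: quantile_loss_def abs_mult intro!: mult_right_mono)
  qed
qed

text \<open>Taking expectations in \<open>quantile_loss_slope\<close> turns the indicator of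
  \<open>{..x}\<close> into \<open>cdf M x\<close>.\<close>

lemma expected_loss_slope:
  assumes "real_distribution M" and id: "integrable M (\<lambda>s. s)" and ab: "a \<le> b"
  shows "(b - a) * (cdf M a - \<alpha>) \<le> expected_loss M \<alpha> b - expected_loss M \<alpha> a"
    and "expected_loss M \<alpha> b - expected_loss M \<alpha> a \<le> (b - a) * (cdf M b - \<alpha>)"
proof -
  interpret real_distribution M by fact
  note int = integrable_quantile_loss[OF \<open>real_distribution M\<close> id]
  have ind: "integrable M (indicat_real {..x})" for x
    by (intro integrable_real_indicator) (simp_all add: emeasure_eq_measure)
  then have int': "integrable M (\<lambda>s. (b - a) * (indicat_real {..x} s - \<alpha>))" for x
    by (intro integrable_mult_right Bochner_Integration.integrable_diff) auto
  have diff: "expected_loss M \<alpha> b - expected_loss M \<alpha> a =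
      (LINT s|M. quantile_loss \<alpha> b s - quantile_loss \<alpha> a s)"
    by (simp add: expected_loss_def int)
  have F: "(LINT s|M. (b - a) * (indicat_real {..x} s - \<alpha>)) = (b - a) * (cdf M x - \<alpha>)" for x
    using ind[of x] prob_space by (simp add: cdf_def)
  show "(b - a) * (cdf M a - \<alpha>) \<le> expected_loss M \<alpha> b - expected_loss M \<alpha> a"
    unfolding diff F[symmetric]
    by (intro integral_mono quantile_loss_slope ab) (use int int' in auto)
  show "expected_loss M \<alpha> b - expected_loss M \<alpha> a \<le> (b - a) * (cdf M b - \<alpha>)"
    unfolding diff F[symmetric]
    by (intro integral_mono quantile_loss_slope ab) (use int int' in auto)
qed

text \<open>The absence of an atom at \<open>x\<close> means continuity of the distribution function
  there, so the two slope bounds close up.\<close>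

lemma has_real_derivative_expected_loss:
  assumes "real_distribution M" and id: "integrable M (\<lambda>s. s)" and x: "measure M {x} = 0"
  shows "(expected_loss M \<alpha> has_real_derivative cdf M x - \<alpha>) (at x)"
proof -
  interpret real_distribution M by fact
  have "isCont (cdf M) x" using x by (simp add: isCont_cdf)
  then show ?thesis
    by (intro has_real_derivative_slope[where g = "\<lambda>x. cdf M x - \<alpha>"]
          expected_loss_slope[OF assms(1,2)]) auto
qed

section \<open>Mixtures and empirical distributions\<close>

text \<open>This handles the first round, where the second component is the zero measure and enters
  with weight zero.\<close>

lemma mixture_1: "sets N = sets M \<Longrightarrow> mixture 1 M N = M"
  by (rule measure_eqI) (simp_all add: emeasure_mixture)

lemma measure_mixture:
  assumes "finite_measure M" "finite_measure N" and "sets N = sets M" "A \<in> sets M"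
    and "0 \<le> w" "w \<le> 1"
  shows "measure (mixture w M N) A = w * measure M A + (1 - w) * measure N A"
proof -
  interpret M: finite_measure M by fact
  interpret N: finite_measure N by fact
  have "emeasure (mixture w M N) A = ennreal (w * measure M A + (1 - w) * measure N A)"
    using assms by (simp add: emeasure_mixture M.emeasure_eq_measure N.emeasure_eq_measure
        ennreal_mult'[symmetric] ennreal_plus[symmetric] del: ennreal_plus)
  then show ?thesis
    using assms(5,6) by (intro measure_eq_emeasure_eq_ennreal) simp_all
qed

lemma real_distribution_mixture:
  assumes "real_distribution M" "real_distribution N" "0 \<le> w" "w \<le> 1"
  shows "real_distribution (mixture w M N)"
proof -
  interpret M: real_distribution M by fact
  interpret N: real_distribution N by fact
  have "emeasure (mixture w M N) UNIV = ennreal w + ennreal (1 - w)"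
    using M.emeasure_space_1 N.emeasure_space_1
    by (subst emeasure_mixture) simp_all
  also have "\<dots> = 1" using assms(3,4) by (simp flip: ennreal_plus)
  finally interpret prob_space "mixture w M N"
    by (intro prob_spaceI) simp
  show ?thesis
    by unfold_locales simp_all
qed

lemma real_distribution_empirical:
  assumes "n \<ge> 1"
  shows "real_distribution (empirical rs n)"
proof -
  interpret prob_space "uniform_count_measure {1..n}"
    using assms by (intro prob_space_uniform_count_measure) auto
  show ?thesis unfolding empirical_def
    by (intro real_distribution_distr) (simp add: measurable_def space_uniform_count_measure
        sets_uniform_count_measure)
qed

lemma measure_empirical:
  assumes "A \<in> sets borel"
  shows "measure (empirical rs n) A = (\<Sum>i=1..n. indicator A (rs i)) / n"
proof -
  have "rs \<in> measurable (uniform_count_measure {1..n}) borel"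
    by (simp add: measurable_def space_uniform_count_measure sets_uniform_count_measure)
  then have "measure (empirical rs n) A =
      measure (uniform_count_measure {1..n}) (rs -` A \<inter> {1..n})"
    using assms by (simp add: empirical_def measure_distr space_uniform_count_measure)
  also have "\<dots> = card (rs -` A \<inter> {1..n}) / n"
    by (subst measure_uniform_count_measure) auto
  also have "real (card (rs -` A \<inter> {1..n})) = (\<Sum>i=1..n. indicator A (rs i))"
    by (simp add: indicator_def sum.If_cases Int_def vimage_def conj_commute)
  finally show ?thesis .
qed

section \<open>Distributions with a positive density on an interval\<close>

text \<open>The mass of \<open>{x<..y}\<close> is at least \<mu> times its length. Since the
  expected loss has derivative \<open>cdf M x - \<alpha>\<close>, this is the growth condition for
  strong convexity.\<close>

lemma cdf_density_growth:
  assumes p: "set_borel_measurable lborel {a..b} p"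
    and M: "real_distribution M"
    and dens: "M = density lborel (\<lambda>r. ennreal (indicator {a..b} r * p r))"
    and low: "\<And>r. r \<in> {a..b} \<Longrightarrow> \<mu> \<le> p r" and \<mu>: "0 \<le> \<mu>"
    and xy: "x \<in> {a..b}" "y \<in> {a..b}" "x \<le> y"
  shows "\<mu> * (y - x) \<le> cdf M y - cdf M x"
proof (cases "x = y")
  case False
  interpret real_distribution M by fact
  have [measurable]: "(\<lambda>r. indicator {a..b} r * p r) \<in> borel_measurable lborel"
    using p by (simp add: set_borel_measurable_def)
  have "ennreal (\<mu> * (y - x)) = (\<integral>\<^sup>+r. ennreal \<mu> * indicator {x<..y} r \<partial>lborel)"
    using \<mu> xy by (simp add: nn_integral_cmult ennreal_mult')
  also have "\<dots> \<le> (\<integral>\<^sup>+r. ennreal (indicator {a..b} r * p r) * indicator {x<..y} r \<partial>lborel)"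
    using xy low by (intro nn_integral_mono) (auto simp: indicator_def intro!: ennreal_leI)
  also have "\<dots> = emeasure M {x<..y}"
    unfolding dens by (subst emeasure_density) auto
  finally have "\<mu> * (y - x) \<le> measure M {x<..y}"
    using \<mu> xy by (simp add: emeasure_eq_measure)
  also have "\<dots> = cdf M y - cdf M x" using cdf_diff_eq[of x y] False xy by simp
  finally show ?thesis .
qed simp

text \<open>Pointwise positivity gives no uniform lower bound, so the argument goes through null
  sets: if \<open>{x<..y}\<close> had mass zero, a positive density would vanish almost everywhere
  on a set of positive length.\<close>

lemma strict_mono_on_cdf_density:
  assumes p: "set_borel_measurable lborel {a..b} p"
    and M: "real_distribution M"
    and dens: "M = density lborel (\<lambda>r. ennreal (indicator {a..b} r * p r))"
    and pos: "\<And>r. r \<in> {a..b} \<Longrightarrow> p r > 0"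
  shows "strict_mono_on {a..b} (cdf M)"
proof (rule strict_mono_onI)
  fix x y assume xy: "x \<in> {a..b}" "y \<in> {a..b}" "x < y"
  interpret real_distribution M by fact
  have [measurable]: "(\<lambda>r. indicator {a..b} r * p r) \<in> borel_measurable lborel"
    using p by (simp add: set_borel_measurable_def)
  have "emeasure M {x<..y} \<noteq> 0"
  proof
    assume "emeasure M {x<..y} = 0"
    then have "{x<..y} \<in> null_sets M" by auto
    then have "AE r in lborel. r \<in> {x<..y} \<longrightarrow> ennreal (indicator {a..b} r * p r) = 0"
      unfolding dens by (subst (asm) null_sets_density_iff) auto
    then have "AE r in lborel. r \<notin> {x<..y}"
    proof eventually_elim
      case (elim r)
      show ?case using elim pos[of r] xy by (auto simp: ennreal_eq_0_iff)
    qed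
    then have "emeasure lborel {x<..y} = 0"
      by (subst (asm) AE_iff_measurable[of "{x<..y}"]) auto
    with xy(3) show False by simp
  qed
  then have "measure M {x<..y} > 0"
    by (simp add: emeasure_eq_measure zero_less_measure_iff)
  then show "cdf M x < cdf M y" using cdf_diff_eq[OF xy(3)] by simp
qed

lemma AE_density_indicator:
  fixes p :: "real \<Rightarrow> real"
  assumes "set_borel_measurable lborel S p"
  shows "AE r in density lborel (\<lambda>r. ennreal (indicator S r * p r)). r \<in> S"
proof -
  have "(\<lambda>r. ennreal (indicator S r * p r)) \<in> borel_measurable lborel"
    using assms by (intro measurable_compose[OF _ measurable_ennreal])
      (simp add: set_borel_measurable_def)
  from AE_density[OF this] show ?thesis by (simp add: indicator_def)
qed

lemma measure_density_singleton:
  fixes p :: "real \<Rightarrow> real"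
  assumes "set_borel_measurable lborel S p"
  shows "measure (density lborel (\<lambda>r. ennreal (indicator S r * p r))) {x} = 0"
proof -
  have meas: "(\<lambda>r. ennreal (indicator S r * p r)) \<in> borel_measurable lborel"
    using assms by (intro measurable_compose[OF _ measurable_ennreal])
      (simp add: set_borel_measurable_def)
  have "AE r in lborel. r \<in> {x} \<longrightarrow> ennreal (indicator S r * p r) = 0"
    using AE_lborel_singleton[of x] by eventually_elim simp
  then have "{x} \<in> null_sets (density lborel (\<lambda>r. ennreal (indicator S r * p r)))"
    unfolding null_sets_density_iff[OF meas] by (intro conjI) simp_all
  then show ?thesis by (auto simp: measure_def)
qed

section \<open>The regularized-belief algorithm\<close>

text \<open>The minimizers are intersected with \<open>{0..R}\<close> because for \<alpha> = 0 both
  objectives are constant on the nonpositive reals, and for \<alpha> = 1 on the reals from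
  \<open>R\<close> upwards. Strong convexity and the quadratic formula are confined to
  \<open>{0..R}\<close> because \<psi> is affine on either side of it.\<close>

theorem theorem1:
  fixes R :: real and P0 :: "real measure" and p0 :: "real \<Rightarrow> real"
    and lam :: "nat \<Rightarrow> real" and rs :: "nat \<Rightarrow> real"
  assumes R: "R > 0"
    and P0: "prob_space P0"
    and p0_meas: "set_borel_measurable lborel {0..R} p0"
    and p0_pos: "\<And>r. r \<in> {0..R} \<Longrightarrow> p0 r > 0"
    and P0_density: "P0 = density lborel (\<lambda>r. ennreal (indicator {0..R} r * p0 r))"
    and lam_1: "lam 1 = 1"
    and lam: "\<And>t. t \<ge> 2 \<Longrightarrow> 0 < lam t \<and> lam t < 1"
    and rs: "\<And>t. t \<ge> 1 \<Longrightarrow> rs t \<in> {0..R}"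
  shows "\<forall>\<alpha>\<in>{0..1}. let
      \<psi> = expected_loss P0 \<alpha>;
      obj = (\<lambda>t r. lam t * (real t - 1) / (1 - lam t) * \<psi> r
                    + (\<Sum>i = 1..t - 1. quantile_loss \<alpha> r (rs i)))
    in
      Argmin \<psi> \<inter> {0..R} = {threshold R P0 lam rs 1 \<alpha>} \<and>
      (0 < \<alpha> \<and> \<alpha> < 1 \<longrightarrow> Argmin \<psi> = {threshold R P0 lam rs 1 \<alpha>}) \<and>
      (\<forall>t\<ge>2. Argmin (obj t) \<inter> {0..R} = {threshold R P0 lam rs t \<alpha>} \<and>
              (0 < \<alpha> \<and> \<alpha> < 1 \<longrightarrow> Argmin (obj t) = {threshold R P0 lam rs t \<alpha>})) \<and>
      ((INF r\<in>{0..R}. p0 r) > 0 \<longrightarrow> strongly_convex_on {0..R} (INF r\<in>{0..R}. p0 r) \<psi>) \<and>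
      (P0 = uniform_measure lborel {0..R} \<longrightarrow>
        (\<forall>r\<in>{0..R}. \<psi> r = 1 / (2 * R) * r\<^sup>2 - \<alpha> * r + 1 / 2 * \<alpha> * R) \<and>
        (\<exists>c. \<forall>r\<in>{0..R}. \<psi> r = 1 / (2 * R) * (r - \<alpha> * R)\<^sup>2 + c))"
proof -

  \<comment> \<open>Regularity of the prior\<close>
  interpret prob_space P0 by fact
  have sets_P0 [simp]: "sets P0 = sets borel" and space_P0 [simp]: "space P0 = UNIV"
    by (simp_all add: P0_density)
  have M: "real_distribution P0" by unfold_locales simp_all
  have AE: "AE s in P0. s \<in> {0..R}"
    unfolding P0_density using p0_meas by (rule AE_density_indicator)
  then have supp: "measure P0 {0..R} = 1" by (simp add: prob_eq_1)
  from AE have "AE s in P0. norm s \<le> R" by eventually_elim auto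
  then have id: "integrable P0 (\<lambda>s. s)"
    by (rule integrable_const_bound) (rule measurable_ident_sets[OF sets_P0])
  have strict: "strict_mono_on {0..R} (cdf P0)"
    using strict_mono_on_cdf_density[OF p0_meas M P0_density p0_pos] .
  have atom: "measure P0 {x} = 0" for x
    unfolding P0_density using p0_meas by (rule measure_density_singleton)
  note slope = expected_loss_slope[OF M id]
  note deriv = has_real_derivative_expected_loss[OF M id atom]
  have R0: "0 \<le> R" using R by simp

  \<comment> \<open>First round: the quantile of the prior\<close>
  have first: "Argmin (expected_loss P0 \<alpha>) \<inter> {0..R} = {threshold R P0 lam rs 1 \<alpha>}"
      "0 < \<alpha> \<and> \<alpha> < 1 \<longrightarrow> Argmin (expected_loss P0 \<alpha>) = {threshold R P0 lam rs 1 \<alpha>}"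
    if \<alpha>: "\<alpha> \<in> {0..1}" for \<alpha>
  proof -
    have "belief P0 lam rs 1 = P0"
      by (simp add: belief_def lam_1[simplified] mixture_1 empirical_def)
    then have q: "quantile_in {0..R} P0 \<alpha> = threshold R P0 lam rs 1 \<alpha>"
      by (simp add: threshold_def)
    note Argmin = Argmin_eq_quantile[OF M supp R0 strict \<alpha>, where K = 1, unfolded q]
    show "Argmin (expected_loss P0 \<alpha>) \<inter> {0..R} = {threshold R P0 lam rs 1 \<alpha>}"
      by (rule Argmin) (simp_all add: slope)
    show "0 < \<alpha> \<and> \<alpha> < 1 \<longrightarrow> Argmin (expected_loss P0 \<alpha>) = {threshold R P0 lam rs 1 \<alpha>}"
      by (intro impI Argmin) (simp_all add: slope)
  qed

  \<comment> \<open>Later rounds: the regularized objective\<close>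
  define obj where "obj \<alpha> t r = lam t * (real t - 1) / (1 - lam t) * expected_loss P0 \<alpha> r
      + (\<Sum>i = 1..t - 1. quantile_loss \<alpha> r (rs i))" for \<alpha> t r
  have later: "Argmin (obj \<alpha> t) \<inter> {0..R} = {threshold R P0 lam rs t \<alpha>} \<and>
      (0 < \<alpha> \<and> \<alpha> < 1 \<longrightarrow> Argmin (obj \<alpha> t) = {threshold R P0 lam rs t \<alpha>})"
    if \<alpha>: "\<alpha> \<in> {0..1}" and t: "t \<ge> 2" for \<alpha> t
  proof -
    define n where "n = t - 1"
    have n: "n \<ge> 1" "real t - 1 = real n" using t by (auto simp: n_def)
    have l: "0 < lam t" "lam t < 1" using lam[OF t] by auto
    \<comment> \<open>This factor makes \<open>K * lam t\<close> the coefficient of the expected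
      loss and \<open>K * (1 - lam t)\<close> equal to \<open>n\<close>, which turns the empirical
      average into a sum over the observed scores.\<close>
    define K where "K = real n / (1 - lam t)"
    have K: "K > 0" using n l by (simp add: K_def)
    have E: "real_distribution (empirical rs n)"
      using n(1) by (rule real_distribution_empirical)
    interpret E: real_distribution "empirical rs n" by (rule E)
    define B where "B = belief P0 lam rs t"
    have B_mix: "B = mixture (lam t) P0 (empirical rs n)"
      by (simp add: B_def belief_def n_def)
    have B: "real_distribution B"
      unfolding B_mix using M E l by (intro real_distribution_mixture) auto
    have meas_B: "measure B A = lam t * measure P0 A + (1 - lam t) * measure (empirical rs n) A"
      if "A \<in> sets borel" for A
      unfolding B_mix using that l
      by (intro measure_mixture) (auto intro: finite_measure_axioms E.finite_measure_axioms)
    have "measure (empirical rs n) {0..R} = 1"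
      using rs n(1) by (simp add: measure_empirical)
    then have supp_B: "measure B {0..R} = 1"
      by (simp add: meas_B supp)
    have cdf_B: "cdf B x = lam t * cdf P0 x + (1 - lam t) * cdf (empirical rs n) x" for x
      by (simp add: cdf_def meas_B)
    \<comment> \<open>The empirical part is a nondecreasing step function; strictness comes from the
      prior, whose weight \<open>lam t\<close> is positive.\<close>
    have strict_B: "strict_mono_on {0..R} (cdf B)"
      using strict l E.cdf_nondecreasing
      by (auto simp: strict_mono_on_def cdf_B intro!: add_less_le_mono mult_left_mono)
    \<comment> \<open>The scaled slope of the belief splits into the slope of the weighted expected
      loss and those of the single losses; the terms in \<alpha> match because the mixture weights
      add up to 1.\<close>
    have K_cdf: "K * ((y - x) * (cdf B z - \<alpha>)) =
        lam t * (real t - 1) / (1 - lam t) * ((y - x) * (cdf P0 z - \<alpha>))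
        + (\<Sum>i = 1..t - 1. (y - x) * (indicat_real {..z} (rs i) - \<alpha>))" for x y z
    proof -
      have "(\<Sum>i = 1..t - 1. (y - x) * (indicat_real {..z} (rs i) - \<alpha>)) =
          (y - x) * ((\<Sum>i = 1..n. indicat_real {..z} (rs i)) - n * \<alpha>)"
        by (simp add: n_def sum_distrib_left[symmetric] sum_subtractf)
      also have "(\<Sum>i = 1..n. indicat_real {..z} (rs i)) = n * cdf (empirical rs n) z"
        using n(1) by (simp add: cdf_def measure_empirical)
      finally have sum: "(\<Sum>i = 1..t - 1. (y - x) * (indicat_real {..z} (rs i) - \<alpha>)) =
          (y - x) * (n * cdf (empirical rs n) z - n * \<alpha>)" .
      show ?thesis unfolding sum n(2) K_def cdf_B using l by (simp add: field_simps)
    qed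
    have c: "0 \<le> lam t * (real t - 1) / (1 - lam t)" using l n by simp
    have obj_diff: "obj \<alpha> t y - obj \<alpha> t x =
        lam t * (real t - 1) / (1 - lam t) * (expected_loss P0 \<alpha> y - expected_loss P0 \<alpha> x)
        + (\<Sum>i = 1..t - 1. quantile_loss \<alpha> y (rs i) - quantile_loss \<alpha> x (rs i))" for x y
      by (simp add: obj_def sum_subtractf right_diff_distrib)
    have lower: "K * ((y - x) * (cdf B x - \<alpha>)) \<le> obj \<alpha> t y - obj \<alpha> t x" if "x \<le> y" for x y
      unfolding K_cdf obj_diff
      by (intro add_mono mult_left_mono[OF _ c] sum_mono slope quantile_loss_slope that)
    have upper: "obj \<alpha> t y - obj \<alpha> t x \<le> K * ((y - x) * (cdf B y - \<alpha>))" if "x \<le> y" for x y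
      unfolding K_cdf obj_diff
      by (intro add_mono mult_left_mono[OF _ c] sum_mono slope quantile_loss_slope that)
    have "quantile_in {0..R} B \<alpha> = threshold R P0 lam rs t \<alpha>"
      by (simp add: threshold_def B_def)
    then show ?thesis
      using Argmin_eq_quantile[OF B supp_B R0 strict_B \<alpha> K lower upper] by simp
  qed

  \<comment> \<open>Strong convexity of the expected loss\<close>
  have sc: "strongly_convex_on {0..R} (INF r\<in>{0..R}. p0 r) (expected_loss P0 \<alpha>)"
    if pos: "(INF r\<in>{0..R}. p0 r) > 0" for \<alpha>
  proof (rule strongly_convex_on_realI[OF _ deriv])
    fix x y assume xy: "x \<in> {0..R}" "y \<in> {0..R}" "x \<le> y"
    \<comment> \<open>Boundedness below makes the infimum a genuine lower bound of the density; here
      0 is such a bound.\<close>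
    have "bdd_below (p0 ` {0..R})"
      using p0_pos by (intro bdd_belowI2[of _ 0]) (auto intro: less_imp_le)
    then have "(INF r\<in>{0..R}. p0 r) \<le> p0 r" if "r \<in> {0..R}" for r
      using that by (rule cINF_lower)
    from cdf_density_growth[OF p0_meas M P0_density this less_imp_le[OF pos] xy]
    show "(INF r\<in>{0..R}. p0 r) * (y - x) \<le> cdf P0 y - \<alpha> - (cdf P0 x - \<alpha>)" by simp
  qed simp

  \<comment> \<open>The uniform prior\<close>
  have unif: "expected_loss P0 \<alpha> r = 1 / (2 * R) * r\<^sup>2 - \<alpha> * r + 1 / 2 * \<alpha> * R"
    if P0_unif: "P0 = uniform_measure lborel {0..R}" and r: "r \<in> {0..R}" for \<alpha> r
  proof -
    have cdf: "cdf P0 x = x / R" if "x \<in> {0..R}" for x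
    proof -
      have "{0..R} \<inter> {..x} = {0..x}" using that by auto
      then show ?thesis using that R
        unfolding P0_unif by (simp add: cdf_def measure_uniform_measure)
    qed
    \<comment> \<open>On the interval both functions have derivative
      \<open>x / R - \<alpha>\<close>, so they differ by a constant.\<close>
    have "\<exists>c. \<forall>x\<in>{0..R}. expected_loss P0 \<alpha> x - (x\<^sup>2 / (2 * R) - \<alpha> * x) = c"
    proof (rule has_field_derivative_zero_constant)
      fix x assume x: "x \<in> {0..R}"
      have "((\<lambda>x. expected_loss P0 \<alpha> x - (x\<^sup>2 / (2 * R) - \<alpha> * x)) has_real_derivative 0) (at x)"
        using R by (auto intro!: derivative_eq_intros deriv simp: cdf[OF x])
      then show "((\<lambda>x. expected_loss P0 \<alpha> x - (x\<^sup>2 / (2 * R) - \<alpha> * x)) has_real_derivative 0)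
          (at x within {0..R})"
        by (rule has_field_derivative_at_within)
    qed simp
    then obtain c where c: "\<And>x. x \<in> {0..R} \<Longrightarrow>
        expected_loss P0 \<alpha> x = x\<^sup>2 / (2 * R) - \<alpha> * x + c"
      by (metis add.commute diff_add_cancel)
    \<comment> \<open>The two endpoint values are both affine in the mean, so they determine the mean and
      thereby the constant of integration.\<close>
    define m where "m = (LINT s|P0. s)"
    have meas: "quantile_loss \<alpha> x \<in> borel_measurable P0" for x
      using integrable_quantile_loss[OF M id] by (rule borel_measurable_integrable)
    have "AE s in P0. quantile_loss \<alpha> 0 s = \<alpha> * s"
      using AE by eventually_elim (auto simp: quantile_loss_def)
    then have "expected_loss P0 \<alpha> 0 = (LINT s|P0. \<alpha> * s)"
      unfolding expected_loss_def using id
      by (intro integral_cong_AE meas borel_measurable_integrable) simp_all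
    then have at0: "expected_loss P0 \<alpha> 0 = \<alpha> * m" by (simp add: m_def)
    have "AE s in P0. quantile_loss \<alpha> R s = (1 - \<alpha>) * (R - s)"
      using AE by eventually_elim (auto simp: quantile_loss_def)
    then have "expected_loss P0 \<alpha> R = (LINT s|P0. (1 - \<alpha>) * (R - s))"
      unfolding expected_loss_def using id
      by (intro integral_cong_AE meas borel_measurable_integrable) simp_all
    also have "\<dots> = (1 - \<alpha>) * (R - m)"
      using id prob_space by (simp add: m_def)
    finally have atR: "expected_loss P0 \<alpha> R = (1 - \<alpha>) * (R - m)" .
    have "R\<^sup>2 / (2 * R) = R / 2" using R by (simp add: power2_eq_square)
    \<comment> \<open>The value at 0 gives \<open>c = \<alpha> * m\<close>. After substitution into
      the value at \<open>R\<close> every term in \<alpha> cancels, so the mean is determined for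
      each \<alpha>, including 0 and 1.\<close>
    then have "R - m = R / 2"
      using c[of 0] c[of R] R0 at0 atR by (simp add: algebra_simps)
    then have "R = 2 * m" by simp
    then have "c = 1 / 2 * \<alpha> * R" using c[of 0] R0 at0 by simp
    with c[OF r] show ?thesis by simp
  qed
  have unif': "\<exists>c. \<forall>r\<in>{0..R}. expected_loss P0 \<alpha> r = 1 / (2 * R) * (r - \<alpha> * R)\<^sup>2 + c"
    if "P0 = uniform_measure lborel {0..R}" for \<alpha>
  proof (intro exI ballI)
    fix r assume r: "r \<in> {0..R}"
    \<comment> \<open>Completing the square leaves the constant
      \<open>\<alpha> * (1 - \<alpha>) * R / 2\<close>.\<close>
    have "1 / (2 * R) * (r - \<alpha> * R)\<^sup>2 = 1 / (2 * R) * r\<^sup>2 - \<alpha> * r + \<alpha>\<^sup>2 * R / 2"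
      using R by (simp add: power2_eq_square field_simps)
    then show "expected_loss P0 \<alpha> r =
        1 / (2 * R) * (r - \<alpha> * R)\<^sup>2 + (1 / 2 * \<alpha> * R - \<alpha>\<^sup>2 * R / 2)"
      unfolding unif[OF that r] by linarith
  qed

  show ?thesis
    unfolding Let_def obj_def[symmetric]
  proof (intro ballI conjI)
    fix \<alpha> :: real assume \<alpha>: "\<alpha> \<in> {0..1}"
    note first[OF \<alpha>]
    then show "Argmin (expected_loss P0 \<alpha>) \<inter> {0..R} = {threshold R P0 lam rs 1 \<alpha>}"
      and "0 < \<alpha> \<and> \<alpha> < 1 \<longrightarrow> Argmin (expected_loss P0 \<alpha>) = {threshold R P0 lam rs 1 \<alpha>}" .
    show "\<forall>t\<ge>2. Argmin (obj \<alpha> t) \<inter> {0..R} = {threshold R P0 lam rs t \<alpha>} \<and>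
        (0 < \<alpha> \<and> \<alpha> < 1 \<longrightarrow> Argmin (obj \<alpha> t) = {threshold R P0 lam rs t \<alpha>})"
      using later[OF \<alpha>] by blast
  qed (use sc unif unif' in blast)+
qed

end
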